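(* Let $\gamma$ be a closed plane wave front with an odd number of cusps, total rotation $\pi$ and without inflections. Let the midpoint of a segment of length $2L$ traverse $\gamma$ so that the segment remains tangent to $\gamma$. Then, for all sufficiently large $L$, the endpoints of the segment traverse a closed smooth convex bicycle curve $\Gamma$.
   Context: A (plane) wave front is a closed plane curve that is smooth except possibly for cusp singularities and that has a well-defined tangent line at every point, including the cusps, varying smoothly along the curve (at a cusp the direction of motion of the point reverses and the curvature becomes infinite and changes sign). The total rotation is the total angle through which the tangent line turns when the front is traversed once. "Without inflections" means that the curvature of the front does not vanish (the tangent line turns with non-vanishing angular speed). The oriented segment is carried continuously along $\gamma$, its line being the tangent line of $\gamma$ at its midpoint; after one traversal of $\gamma$ the segment returns with its two endpoints interchanged, so each endpoint describes one part of $\Gamma$ during one traversal. A bicycle curve is a closed smooth plane curve $\Gamma$ such that a pair of points $x,y$ can traverse $\Gamma$ so that both the distance between $x$ and $y$ along $\Gamma$ and the distance between $x$ and $y$ in the plane do not change. *)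

theory Defs
  imports "HOL-Analysis.Analysis"
begin

text \<open>
  The plane is identified with the complex numbers, so that \<open>cis \<phi>\<close> is the unit vector at angle
  \<open>\<phi>\<close>. Closed curves are periodic maps on the real line, together with a period that
  corresponds to one traversal.
\<close>

definition smooth :: "(real \<Rightarrow> 'a::real_normed_vector) \<Rightarrow> bool" where
  "smooth f \<longleftrightarrow> (\<exists>F :: nat \<Rightarrow> real \<Rightarrow> 'a. F 0 = f \<and>
     (\<forall>n t. (F n has_vector_derivative F (Suc n) t) (at t)))"


subsection \<open>Wave fronts\<close>

text \<open>
  A front is given by a smooth map \<open>\<gamma>\<close> and a smooth angle \<open>\<theta>\<close> of its tangent line. The angle
  orients the tangent line consistently through the cusps, so the speed and the curvature below
  are signed with respect to this orientation and not to the direction of motion: for arc length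
  \<open>s\<close> with \<open>ds = signed_speed dt\<close>, the curvature is \<open>d\<theta>/ds\<close>.
\<close>

definition signed_speed :: "(real \<Rightarrow> complex) \<Rightarrow> (real \<Rightarrow> real) \<Rightarrow> real \<Rightarrow> real" where
  "signed_speed \<gamma> \<theta> t = vector_derivative \<gamma> (at t) \<bullet> cis (\<theta> t)"

definition front_curvature :: "(real \<Rightarrow> complex) \<Rightarrow> (real \<Rightarrow> real) \<Rightarrow> real \<Rightarrow> real" where
  "front_curvature \<gamma> \<theta> t = deriv \<theta> t / signed_speed \<gamma> \<theta> t"

definition changes_sign_at :: "(real \<Rightarrow> real) \<Rightarrow> real \<Rightarrow> bool" where
  "changes_sign_at f c \<longleftrightarrow>
     (\<forall>\<^sub>F t in at_left c. f t < 0) \<and> (\<forall>\<^sub>F t in at_right c. f t > 0) \<or>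
     (\<forall>\<^sub>F t in at_left c. f t > 0) \<and> (\<forall>\<^sub>F t in at_right c. f t < 0)"

definition is_cusp :: "(real \<Rightarrow> complex) \<Rightarrow> (real \<Rightarrow> real) \<Rightarrow> real \<Rightarrow> bool" where
  "is_cusp \<gamma> \<theta> c \<longleftrightarrow>
     vector_derivative \<gamma> (at c) = 0 \<and>
     changes_sign_at (signed_speed \<gamma> \<theta>) c \<and>
     filterlim (front_curvature \<gamma> \<theta>) at_infinity (at c) \<and>
     changes_sign_at (front_curvature \<gamma> \<theta>) c"

text \<open>
  The tangent line is periodic as an unoriented line, hence \<open>\<theta>\<close> is periodic only modulo \<open>pi\<close>.
\<close>

definition wave_front :: "real \<Rightarrow> (real \<Rightarrow> complex) \<Rightarrow> (real \<Rightarrow> real) \<Rightarrow> bool" where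
  "wave_front T \<gamma> \<theta> \<longleftrightarrow>
     T > 0 \<and> smooth \<gamma> \<and> smooth \<theta> \<and>
     (\<forall>t. \<gamma> (t + T) = \<gamma> t) \<and>
     (\<exists>k::int. \<forall>t. \<theta> (t + T) = \<theta> t + of_int k * pi) \<and>
     (\<forall>t. \<exists>v::real. vector_derivative \<gamma> (at t) = v *\<^sub>R cis (\<theta> t)) \<and>
     (\<forall>t. vector_derivative \<gamma> (at t) = 0 \<longrightarrow> is_cusp \<gamma> \<theta> t)"

definition cusps :: "real \<Rightarrow> (real \<Rightarrow> complex) \<Rightarrow> (real \<Rightarrow> real) \<Rightarrow> real set" where
  "cusps T \<gamma> \<theta> = {t \<in> {0..<T}. is_cusp \<gamma> \<theta> t}"

text \<open>The absolute value makes the total rotation independent of the sense of traversal.\<close>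

definition total_rotation :: "real \<Rightarrow> (real \<Rightarrow> real) \<Rightarrow> real" where
  "total_rotation T \<theta> = \<bar>\<theta> T - \<theta> 0\<bar>"

text \<open>
  Away from the cusps this says that the curvature is nonzero. At a cusp, where the curvature is
  not defined, it says that the tangent line does not stop turning.
\<close>

definition without_inflections :: "(real \<Rightarrow> real) \<Rightarrow> bool" where
  "without_inflections \<theta> \<longleftrightarrow> (\<forall>t. deriv \<theta> t \<noteq> 0)"


subsection \<open>Closed curves and bicycle curves\<close>

definition smooth_closed_curve :: "real \<Rightarrow> (real \<Rightarrow> complex) \<Rightarrow> bool" where
  "smooth_closed_curve P \<Gamma> \<longleftrightarrow>
     P > 0 \<and> smooth \<Gamma> \<and> (\<forall>t. \<Gamma> (t + P) = \<Gamma> t) \<and> (\<forall>t. vector_derivative \<Gamma> (at t) \<noteq> 0)"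

definition convex_curve :: "real \<Rightarrow> (real \<Rightarrow> complex) \<Rightarrow> bool" where
  "convex_curve P \<Gamma> \<longleftrightarrow>
     inj_on \<Gamma> {0..<P} \<and>
     (\<exists>K. convex K \<and> compact K \<and> interior K \<noteq> {} \<and> \<Gamma> ` {0..<P} = frontier K)"

definition arc_length :: "(real \<Rightarrow> complex) \<Rightarrow> real \<Rightarrow> real \<Rightarrow> real" where
  "arc_length \<Gamma> a b = integral {a..b} (\<lambda>t. norm (vector_derivative \<Gamma> (at t)))"

text \<open>
  The moving points are \<open>\<Gamma> (x s)\<close> and \<open>\<Gamma> (y s)\<close>; each goes once around \<open>\<Gamma>\<close> as \<open>s\<close> increases by 1.
  The bounds on \<open>l\<close> and \<open>d\<close> exclude the trivial pairs in which the two points coincide.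
\<close>

definition bicycle_curve :: "real \<Rightarrow> (real \<Rightarrow> complex) \<Rightarrow> bool" where
  "bicycle_curve P \<Gamma> \<longleftrightarrow>
     smooth_closed_curve P \<Gamma> \<and>
     (\<exists>x y :: real \<Rightarrow> real. \<exists>l d :: real.
        continuous_on UNIV x \<and> continuous_on UNIV y \<and>
        strict_mono x \<and> strict_mono y \<and>
        (\<forall>s. x (s + 1) = x s + P) \<and> (\<forall>s. y (s + 1) = y s + P) \<and>
        0 < l \<and> l < arc_length \<Gamma> 0 P \<and> 0 < d \<and>
        (\<forall>s. x s < y s \<and> arc_length \<Gamma> (x s) (y s) = l) \<and>
        (\<forall>s. dist (\<Gamma> (x s)) (\<Gamma> (y s)) = d))"

end

theory Submission
  imports Defs
begin

text \<open>
  The total rotation \<open>\<plusminus> pi\<close> makes the signed speed \<open>v\<close> of \<open>\<gamma>\<close> change sign after one traversal,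
  while \<open>\<theta>'\<close> is \<open>T\<close>-periodic. The endpoint \<open>\<Gamma> = \<gamma> + L cis \<theta>\<close> has speed
  \<open>sqrt (v\<^sup>2 + L\<^sup>2 \<theta>'\<^sup>2)\<close>, which is positive and \<open>T\<close>-periodic, so the two endpoints \<open>\<Gamma> t\<close> and
  \<open>\<Gamma> (t + T)\<close> always halve the perimeter and stay at distance \<open>2 L\<close>. The normal angle of \<open>\<Gamma>\<close> is
  \<open>\<theta> - arctan (v / (L \<theta>'))\<close>. Its derivative tends uniformly to \<open>\<theta>'\<close> as \<open>L\<close> grows, hence for large
  \<open>L\<close> the normal turns strictly monotonically, exactly once, and every point of \<open>\<Gamma>\<close> is the unique
  extreme point in its normal direction.
\<close>

subsection \<open>Smooth maps\<close>

text \<open>Counting orders opens smoothness to induction: the derivative of a product, or of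
  \<open>cis\<close> after a smooth map, again contains the original factors, which are then needed
  only at the lower order.\<close>

primrec times_differentiable :: "nat \<Rightarrow> (real \<Rightarrow> 'a::real_normed_vector) \<Rightarrow> bool" where
  "times_differentiable 0 f \<longleftrightarrow> True"
| "times_differentiable (Suc n) f \<longleftrightarrow>
     (\<exists>f'. (\<forall>t. (f has_vector_derivative f' t) (at t)) \<and> times_differentiable n f')"

lemma times_differentiable_SucI:
  "(\<And>t. (f has_vector_derivative f' t) (at t)) \<Longrightarrow> times_differentiable n f' \<Longrightarrow>
    times_differentiable (Suc n) f"
  by auto

lemma times_differentiable_SucE:
  assumes "times_differentiable (Suc n) f"
  obtains f' where "\<And>t. (f has_vector_derivative f' t) (at t)" "times_differentiable n f'"
  using assms by auto

lemma times_differentiable_Suc_imp: "times_differentiable (Suc n) f \<Longrightarrow> times_differentiable n f"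
proof (induction n arbitrary: f)
  case (Suc n)
  from Suc.prems obtain f' where f': "\<And>t. (f has_vector_derivative f' t) (at t)"
    and "times_differentiable (Suc n) f'"
    by (rule times_differentiable_SucE) blast
  with Suc.IH have "times_differentiable n f'" by blast
  with f' show ?case by (rule times_differentiable_SucI)
qed simp

text \<open>Each order comes with its own witness for the derivative. Uniqueness of derivatives
  makes all these witnesses agree, so they assemble into the single sequence demanded by
  \<open>smooth\<close>.\<close>

lemma smooth_iff_times_differentiable: "smooth f \<longleftrightarrow> (\<forall>n. times_differentiable n f)"
proof
  assume "smooth f"
  then obtain F where F: "F 0 = f" "\<And>n t. (F n has_vector_derivative F (Suc n) t) (at t)"
    unfolding smooth_def by blast
  have "times_differentiable n (F k)" for n k
    by (induction n arbitrary: k) (use F(2) in auto)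
  with F(1) show "\<forall>n. times_differentiable n f" by metis
next
  assume f: "\<forall>n. times_differentiable n f"
  \<comment> \<open>A choice of derivative that does not depend on the order; its iterates on
    \<open>f\<close> form the required sequence.\<close>
  define D :: "(real \<Rightarrow> 'a) \<Rightarrow> real \<Rightarrow> 'a" where "D = (\<lambda>g t. vector_derivative g (at t))"
  have step: "(g has_vector_derivative D g t) (at t)" "times_differentiable n (D g)"
    if g: "\<forall>n. times_differentiable n g" for g n t
  proof -
    from g have "times_differentiable (Suc n) g" by blast
    then obtain g' where g': "\<And>t. (g has_vector_derivative g' t) (at t)" "times_differentiable n g'"
      by (rule times_differentiable_SucE) blast
    have "D g = g'"
      by (auto simp: D_def fun_eq_iff intro: vector_derivative_at g'(1))
    with g' show "(g has_vector_derivative D g t) (at t)" "times_differentiable n (D g)" by auto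
  qed
  have all: "\<forall>n. times_differentiable n ((D ^^ k) f)" for k
    by (induction k) (use f step(2) in auto)
  show "smooth f"
    unfolding smooth_def
    by (rule exI[of _ "\<lambda>k. (D ^^ k) f"]) (use all step(1) in auto)
qed

lemma times_differentiable_add:
  "times_differentiable n f \<Longrightarrow> times_differentiable n g \<Longrightarrow>
    times_differentiable n (\<lambda>t. f t + g t)"
proof (induction n arbitrary: f g)
  case (Suc n)
  obtain f' where f': "\<And>t. (f has_vector_derivative f' t) (at t)" "times_differentiable n f'"
    using Suc.prems(1) by (rule times_differentiable_SucE) blast
  obtain g' where g': "\<And>t. (g has_vector_derivative g' t) (at t)" "times_differentiable n g'"
    using Suc.prems(2) by (rule times_differentiable_SucE) blast
  show ?case
    by (rule times_differentiable_SucI[OF has_vector_derivative_add[OF f'(1) g'(1)]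
          Suc.IH[OF f'(2) g'(2)]])
qed simp

text \<open>Leibniz rule. Stated for a general bilinear map so that it serves both
  \<open>scaleR\<close> and complex multiplication in the derivative of \<open>cis\<close>.\<close>

lemma times_differentiable_bilinear:
  assumes "bounded_bilinear h"
  shows "times_differentiable n f \<Longrightarrow> times_differentiable n g \<Longrightarrow>
    times_differentiable n (\<lambda>t. h (f t) (g t))"
proof (induction n arbitrary: f g)
  case (Suc n)
  obtain f' where f': "\<And>t. (f has_vector_derivative f' t) (at t)" "times_differentiable n f'"
    using Suc.prems(1) by (rule times_differentiable_SucE) blast
  obtain g' where g': "\<And>t. (g has_vector_derivative g' t) (at t)" "times_differentiable n g'"
    using Suc.prems(2) by (rule times_differentiable_SucE) blast
  show ?case
    by (rule times_differentiable_SucI[OF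
          bounded_bilinear.has_vector_derivative[OF assms f'(1) g'(1)]
          times_differentiable_add[OF
            Suc.IH[OF times_differentiable_Suc_imp[OF Suc.prems(1)] g'(2)]
            Suc.IH[OF f'(2) times_differentiable_Suc_imp[OF Suc.prems(2)]]]])
qed simp

lemma times_differentiable_const: "times_differentiable n (\<lambda>t. c)"
proof (induction n arbitrary: c)
  case (Suc n)
  show ?case
    by (rule times_differentiable_SucI[OF has_vector_derivative_const Suc.IH])
qed simp

lemma has_vector_derivative_cis:
  assumes "(f has_vector_derivative f') (at t)"
  shows "((\<lambda>t. cis (f t)) has_vector_derivative f' *\<^sub>R (\<i> * cis (f t))) (at t)"
proof -
  have f: "(f has_real_derivative f') (at t)"
    using assms by (simp add: has_real_derivative_iff_has_vector_derivative)
  show ?thesis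
    unfolding has_vector_derivative_complex_iff
    by (auto intro!: derivative_eq_intros f)
qed

lemma times_differentiable_cis:
  "times_differentiable n f \<Longrightarrow> times_differentiable n (\<lambda>t. cis (f t))"
proof (induction n arbitrary: f)
  case (Suc n)
  obtain f' where f': "\<And>t. (f has_vector_derivative f' t) (at t)" "times_differentiable n f'"
    using Suc.prems by (rule times_differentiable_SucE) blast
  show ?case
    by (rule times_differentiable_SucI[OF has_vector_derivative_cis[OF f'(1)]
          times_differentiable_bilinear[OF bounded_bilinear_scaleR f'(2)
            times_differentiable_bilinear[OF bounded_bilinear_mult times_differentiable_const
              Suc.IH[OF times_differentiable_Suc_imp[OF Suc.prems]]]]])
qed simp

lemma smooth_add_scaleR_cis:
  assumes "smooth \<gamma>" "smooth \<theta>"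
  shows "smooth (\<lambda>t. \<gamma> t + L *\<^sub>R cis (\<theta> t))"
  unfolding smooth_iff_times_differentiable
proof
  fix n
  have \<gamma>: "times_differentiable n \<gamma>" and \<theta>: "times_differentiable n \<theta>"
    using assms by (simp_all add: smooth_iff_times_differentiable)
  have "times_differentiable n (\<lambda>t. L *\<^sub>R cis (\<theta> t))"
    using times_differentiable_bilinear[of scaleR n "\<lambda>_. L" "\<lambda>t. cis (\<theta> t)",
        OF bounded_bilinear_scaleR times_differentiable_const times_differentiable_cis[OF \<theta>]] .
  then show "times_differentiable n (\<lambda>t. \<gamma> t + L *\<^sub>R cis (\<theta> t))"
    using times_differentiable_add[of n \<gamma> "\<lambda>t. L *\<^sub>R cis (\<theta> t)"] \<gamma> by blast
qed


subsection \<open>Periodic functions\<close>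

lemma periodic_representative:
  fixes f :: "real \<Rightarrow> 'a"
  assumes "P > 0" "\<And>t. f (t + P) = f t"
  obtains r where "s \<le> r" "r < s + P" "f r = f t"
proof -
  interpret periodic_fun_simple f P by standard (rule assms(2))
  define k where "k = \<lfloor>(t - s) / P\<rfloor>"
  have "of_int k \<le> (t - s) / P" "(t - s) / P < of_int k + 1"
    unfolding k_def by linarith+
  then have "of_int k * P \<le> t - s" "t - s < (of_int k + 1) * P"
    using assms(1) by (simp_all add: field_simps)
  then show thesis
    using minus_of_int[of t k] by (intro that[of "t - of_int k * P"]) (auto simp: algebra_simps)
qed

lemma range_periodic:
  fixes f :: "real \<Rightarrow> 'a"
  assumes "P > 0" "\<And>t. f (t + P) = f t"
  shows "range f = f ` {0..<P}"
proof -
  have "f t \<in> f ` {0..<P}" for t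
  proof -
    obtain r where "0 \<le> r" "r < 0 + P" "f r = f t"
      by (rule periodic_representative[of P f 0 t, OF assms]) blast
    then show ?thesis by (intro image_eqI[of _ _ r]) auto
  qed
  then show ?thesis by auto
qed

lemma compact_range_periodic:
  fixes f :: "real \<Rightarrow> 'a::topological_space"
  assumes "P > 0" "\<And>t. f (t + P) = f t" "continuous_on UNIV f"
  shows "compact (range f)"
proof -
  have "f ` {0..<P} \<subseteq> f ` {0..P}" by (rule image_mono) auto
  then have "range f = f ` {0..P}"
    using range_periodic[of P f, OF assms(1,2)] by blast
  also have "compact \<dots>"
    by (rule compact_continuous_image[OF continuous_on_subset[OF assms(3)]]) auto
  finally show ?thesis .
qed

lemma integral_period:
  fixes f :: "real \<Rightarrow> real"
  assumes "T > 0" "\<And>t. f (t + T) = f t" "continuous_on UNIV f"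
  shows "integral {a..a + T} f = integral {0..T} f"
proof -
  have int: "f integrable_on {u..v}" for u v
    by (intro integrable_continuous_real continuous_on_subset[OF assms(3)]) auto
  have shift: "integral {u + T..v + T} f = integral {u..v} f" for u v
    using integral_shift_Icc_real[of u v f T] assms(2) by (simp add: o_def add.commute)
  \<comment> \<open>The interval from \<open>u\<close> to \<open>v + T\<close> is split once at
    \<open>v\<close> and once at \<open>u + T\<close>; the two leftover pieces are translates of
    each other by \<open>T\<close>.\<close>
  have *: "integral {u..u + T} f = integral {v..v + T} f" if "u \<le> v" for u v
  proof -
    have "integral {u..v} f + integral {v..v + T} f = integral {u..v + T} f"
      by (rule Henstock_Kurzweil_Integration.integral_combine) (use that assms(1) int in auto)
    moreover have "integral {u..u + T} f + integral {u + T..v + T} f = integral {u..v + T} f"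
      by (rule Henstock_Kurzweil_Integration.integral_combine) (use that assms(1) int in auto)
    ultimately show ?thesis using shift[of u v] by linarith
  qed
  show ?thesis
    using *[of a 0] *[of 0 a] by (cases "a \<le> 0") auto
qed


subsection \<open>Convex curves\<close>

text \<open>The convex body is the hull \<open>K\<close> of the curve. Strict support makes
  \<open>\<Gamma> s\<close> the only maximum of the height in direction \<open>n s\<close>, first on
  the curve and then on \<open>K\<close>. Strictness gives injectivity and places the curve on the
  frontier; since every direction is some \<open>n s\<close>, no other frontier points
  remain.\<close>

lemma convex_curveI_strict_support:
  fixes \<Gamma> n :: "real \<Rightarrow> complex"
  assumes P: "P > 0" and per: "\<And>t. \<Gamma> (t + P) = \<Gamma> t" and cont: "continuous_on UNIV \<Gamma>"
    and supp: "\<And>s t. s < t \<Longrightarrow> t < s + P \<Longrightarrow> (\<Gamma> t - \<Gamma> s) \<bullet> n s < 0"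
    and surj: "\<And>u. norm u = 1 \<Longrightarrow> \<exists>s. n s = u"
  shows "convex_curve P \<Gamma>"
proof -
  define K where "K = convex hull range \<Gamma>"
  have im: "\<Gamma> ` {0..<P} = range \<Gamma>"
    using range_periodic[of P \<Gamma>, OF P per] by simp
  have K: "convex K" "compact K" "range \<Gamma> \<subseteq> K"
    unfolding K_def by (auto intro: compact_convex_hull compact_range_periodic[OF P per cont] hull_inc)
  have dichotomy: "\<Gamma> t = \<Gamma> s \<or> \<Gamma> t \<bullet> n s < \<Gamma> s \<bullet> n s" for s t
  proof -
    obtain r where r: "s \<le> r" "r < s + P" "\<Gamma> r = \<Gamma> t"
      by (rule periodic_representative[of P \<Gamma> s t, OF P per]) blast
    then show ?thesis
      using supp[of s r] by (cases "r = s") (auto simp: inner_diff_left)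
  qed
  have dichotomy_K: "z = \<Gamma> s \<or> z \<bullet> n s < \<Gamma> s \<bullet> n s" if "z \<in> K" for z s
  proof -
    \<comment> \<open>An open half-plane with a single boundary point added is still convex, so
      minimality of the hull carries the strict inequality from the curve to
      \<open>K\<close>.\<close>
    define C where "C = insert (\<Gamma> s) {z. z \<bullet> n s < \<Gamma> s \<bullet> n s}"
    have "convex C"
    proof (rule convexI)
      fix x y and u v :: real
      assume x: "x \<in> C" and y: "y \<in> C" and uv: "0 \<le> u" "0 \<le> v" "u + v = 1"
      define h where "h z = (z - \<Gamma> s) \<bullet> n s" for z
      have C: "C = {z. z = \<Gamma> s \<or> h z < 0}"
        unfolding C_def h_def by (auto simp: inner_diff_left)
      have hc: "h (u *\<^sub>R x + v *\<^sub>R y) = u * h x + v * h y"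
      proof -
        have "u *\<^sub>R x + v *\<^sub>R y - \<Gamma> s = u *\<^sub>R (x - \<Gamma> s) + v *\<^sub>R (y - \<Gamma> s)"
          using uv(3) by (simp add: algebra_simps flip: scaleR_add_left)
        then show ?thesis by (simp add: h_def inner_add_left)
      qed
      have h0: "h x \<le> 0" "h y \<le> 0"
        using x y unfolding C by (auto simp: h_def)
      show "u *\<^sub>R x + v *\<^sub>R y \<in> C"
      proof (cases "u = 0 \<or> v = 0")
        case True
        then show ?thesis using x y uv by auto
      next
        case False
        then have pos: "u > 0" "v > 0" using uv by auto
        show ?thesis
        proof (cases "x = \<Gamma> s \<and> y = \<Gamma> s")
          case True
          then show ?thesis using uv unfolding C by (simp flip: scaleR_add_left)
        next
          case False
          then have "h x < 0 \<or> h y < 0" using x y unfolding C by auto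
          then have "u * h x + v * h y < 0"
            using mult_pos_neg[of u "h x"] mult_pos_neg[of v "h y"] pos h0
              mult_nonneg_nonpos[of u "h x"] mult_nonneg_nonpos[of v "h y"] by linarith
          then show ?thesis unfolding C hc[symmetric] by auto
        qed
      qed
    qed
    moreover have "range \<Gamma> \<subseteq> C"
      unfolding C_def using dichotomy by auto
    ultimately have "K \<subseteq> C" unfolding K_def by (rule hull_minimal[rotated])
    with that show ?thesis unfolding C_def by auto
  qed
  have inj: "inj_on \<Gamma> {0..<P}"
  proof (rule linorder_inj_onI)
    fix s t assume "s < t" "s \<in> {0..<P}" "t \<in> {0..<P}"
    then show "\<Gamma> s \<noteq> \<Gamma> t"
      using supp[of s t] by auto
  qed auto
  \<comment> \<open>A flat \<open>K\<close> would lie in a line. The normal of that line occurs as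
    some \<open>n s\<close>, and in this direction all curve points have equal height, against
    strict support.\<close>
  have int: "interior K \<noteq> {}"
  proof
    assume "interior K = {}"
    then obtain a b where a: "a \<noteq> 0" and ab: "K \<subseteq> {x. a \<bullet> x = b}"
      using empty_interior_subset_hyperplane K(1) by metis
    obtain s where s: "n s = sgn a" using surj[of "sgn a"] a by (auto simp: norm_sgn)
    have "a \<bullet> \<Gamma> t = b" for t using ab K(3) by auto
    then have "(\<Gamma> (s + P/2) - \<Gamma> s) \<bullet> n s = 0"
      unfolding s sgn_div_norm by (simp add: inner_commute[of _ a] inner_diff_right)
    then show False using supp[of s "s + P/2"] P by simp
  qed
  have "frontier K = range \<Gamma>"
  proof
    show "frontier K \<subseteq> range \<Gamma>"
    proof
      fix z assume z: "z \<in> frontier K"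
      then have zK: "z \<in> K" and "z \<notin> rel_interior K"
        using int K(2) by (auto simp: frontier_def closure_closed compact_imp_closed
            rel_interior_nonempty_interior)
      then obtain a where a: "a \<noteq> 0" "\<And>y. y \<in> K \<Longrightarrow> a \<bullet> z \<le> a \<bullet> y"
        using supporting_hyperplane_rel_boundary[OF K(1)] by metis
      \<comment> \<open>The supporting vector \<open>a\<close> points into \<open>K\<close>, so the
        outward normal at \<open>z\<close> is \<open>- sgn a\<close>. The curve point with this
        normal is the unique maximum, hence equal to \<open>z\<close>.\<close>
      obtain s where s: "n s = - sgn a" using surj[of "- sgn a"] a by (auto simp: norm_sgn)
      have "a \<bullet> z \<le> a \<bullet> \<Gamma> s" using a(2) K(3) by auto
      then have "\<Gamma> s \<bullet> n s \<le> z \<bullet> n s"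
        unfolding s sgn_div_norm using a(1) by (simp add: inner_commute[of _ a] mult_left_mono)
      with dichotomy_K[OF zK, of s] show "z \<in> range \<Gamma>" by auto
    qed
    show "range \<Gamma> \<subseteq> frontier K"
    proof clarify
      fix s
      have ns: "n s \<noteq> 0" using supp[of s "s + P/2"] P by auto
      have "\<Gamma> s \<notin> interior K"
      proof
        assume "\<Gamma> s \<in> interior K"
        then obtain e where e: "e > 0" "cball (\<Gamma> s) e \<subseteq> K"
          by (auto simp: mem_interior_cball)
        \<comment> \<open>A step outwards along the normal stays in \<open>K\<close> if
          \<open>\<Gamma> s\<close> is interior, yet it cannot lose height in direction
          \<open>n s\<close>.\<close>
        define z where "z = \<Gamma> s + e *\<^sub>R sgn (n s)"
        have "z \<in> K" using e ns by (auto simp: z_def dist_norm norm_sgn)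
        moreover have "z \<bullet> n s \<ge> \<Gamma> s \<bullet> n s"
          using e(1) by (simp add: z_def inner_add_left sgn_div_norm)
        moreover have "z \<noteq> \<Gamma> s" using e(1) ns by (simp add: z_def sgn_zero_iff)
        ultimately show False using dichotomy_K[of z s] by auto
      qed
      then show "\<Gamma> s \<in> frontier K"
        using K(3) closure_subset by (auto simp: frontier_def)
    qed
  qed
  with K int inj im show ?thesis
    unfolding convex_curve_def by metis
qed

text \<open>
  The normal angle \<open>\<beta>\<close> may run in either direction \<open>\<sigma>\<close>. As \<open>\<rho>\<close> has the same sign, \<open>cis \<beta>\<close> is the
  outward normal in both cases.
\<close>

lemma strict_support_of_turning:
  fixes \<Gamma> :: "real \<Rightarrow> complex" and \<beta> \<rho> :: "real \<Rightarrow> real" and \<sigma> :: real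
  assumes \<sigma>: "\<bar>\<sigma>\<bar> = 1"
    and der: "\<And>t. (\<Gamma> has_vector_derivative \<rho> t *\<^sub>R (\<i> * cis (\<beta> t))) (at t)"
    and \<rho>: "\<And>t. \<sigma> * \<rho> t > 0"
    and mono: "strict_mono (\<lambda>t. \<sigma> * \<beta> t)" and cont: "continuous_on UNIV \<beta>"
    and per: "\<And>t. \<Gamma> (t + P) = \<Gamma> t" and turn: "\<And>t. \<beta> (t + P) = \<beta> t + \<sigma> * (2 * pi)"
    and t: "s < t" "t < s + P"
  shows "(\<Gamma> t - \<Gamma> s) \<bullet> cis (\<beta> s) < 0"
proof -
  have \<sigma>\<sigma>: "\<sigma> * \<sigma> = 1" using \<sigma> by (metis abs_mult_self_eq mult_1)
  define h where "h r = \<sigma> * (\<beta> r - \<beta> s)" for r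
  have h_mono: "h u < h v" if "u < v" for u v
    using strict_monoD[OF mono that] by (simp add: h_def algebra_simps)
  have h_end: "h s = 0" "h (s + P) = 2 * pi"
    using \<sigma>\<sigma> by (simp_all add: h_def turn flip: mult.assoc)
  have h_cont: "continuous_on {s..s + P} h"
    unfolding h_def by (intro continuous_intros continuous_on_subset[OF cont]) auto
  \<comment> \<open>At \<open>m\<close> the normal is opposite to the one at \<open>s\<close>. The
    height \<open>g\<close> in direction \<open>cis (\<beta> s)\<close> has derivative
    \<open>- (\<sigma> * \<rho>) * sin h\<close>, so it falls from 0 until \<open>m\<close> and
    rises back to 0 at \<open>s + P\<close>; in between it is negative.\<close>
  obtain m where m: "s \<le> m" "m \<le> s + P" "h m = pi"
    using IVT'[of h s pi "s + P"] h_end h_cont t by auto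
  define g where "g r = (\<Gamma> r - \<Gamma> s) \<bullet> cis (\<beta> s)" for r
  define g' where "g' r = - (\<sigma> * \<rho> r) * sin (h r)" for r
  have g_der: "(g has_real_derivative g' r) (at r)" for r
  proof -
    have "(g has_vector_derivative (\<rho> r *\<^sub>R (\<i> * cis (\<beta> r))) \<bullet> cis (\<beta> s)) (at r)"
      unfolding g_def
      by (rule bounded_linear.has_vector_derivative[OF bounded_linear_inner_left])
        (auto intro!: derivative_eq_intros der)
    moreover have "(\<rho> r *\<^sub>R (\<i> * cis (\<beta> r))) \<bullet> cis (\<beta> s) = - \<rho> r * sin (\<beta> r - \<beta> s)"
      by (simp add: inner_complex_def sin_diff algebra_simps)
    moreover have "\<sigma> * sin (h r) = sin (\<beta> r - \<beta> s)"
    proof -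
      from \<sigma> consider "\<sigma> = 1" | "\<sigma> = -1" by linarith
      then show ?thesis
        by cases (use sin_minus[of "\<beta> r - \<beta> s"] in \<open>simp_all add: h_def\<close>)
    qed
    moreover have "g' r = - \<rho> r * (\<sigma> * sin (h r))"
      by (simp add: g'_def)
    ultimately show ?thesis
      by (simp add: has_real_derivative_iff_has_vector_derivative)
  qed
  have g_cont: "continuous_on A g" for A
    using g_der by (meson DERIV_isCont continuous_at_imp_continuous_on)
  have g_end: "g s = 0" "g (s + P) = 0"
    by (simp_all add: g_def per)
  show ?thesis
  proof (cases "t \<le> m")
    case True
    have "g s > g t"
    proof (rule DERIV_neg_imp_decreasing_open[OF t(1) _ g_cont])
      fix r assume r: "s < r" "r < t"
      with True have "0 < h r" "h r < pi"
        using h_mono[of s r] h_mono[of r m] h_end m by auto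
      then have "sin (h r) > 0" by (rule sin_gt_zero)
      then have "g' r < 0" unfolding g'_def using \<rho>[of r] by (simp add: mult_neg_pos)
      with g_der show "\<exists>y. (g has_real_derivative y) (at r) \<and> y < 0" by blast
    qed
    with g_end show ?thesis by (simp add: g_def)
  next
    case False
    have "g t < g (s + P)"
    proof (rule DERIV_pos_imp_increasing_open[OF t(2) _ g_cont])
      fix r assume r: "t < r" "r < s + P"
      with False have "pi < h r" "h r < 2 * pi"
        using h_mono[of m r] h_mono[of r "s + P"] h_end m by auto
      then have "sin (h r) < 0" by (intro sin_lt_zero) auto
      then have "g' r > 0" unfolding g'_def using \<rho>[of r] by (simp add: mult_pos_neg)
      with g_der show "\<exists>y. (g has_real_derivative y) (at r) \<and> y > 0" by blast
    qed
    with g_end show ?thesis by (simp add: g_def)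
  qed
qed

text \<open>By the intermediate value theorem the angle sweeps a full turn from
  \<open>\<beta> 0\<close>, upwards or downwards according to \<open>\<sigma>\<close>.\<close>

lemma cis_surj_of_turning:
  fixes \<beta> :: "real \<Rightarrow> real" and \<sigma> :: real
  assumes \<sigma>: "\<bar>\<sigma>\<bar> = 1" and P: "P > 0" and cont: "continuous_on UNIV \<beta>"
    and turn: "\<beta> P = \<beta> 0 + \<sigma> * (2 * pi)" and u: "norm u = 1"
  shows "\<exists>s. cis (\<beta> s) = u"
proof -
  define \<alpha> where "\<alpha> = \<beta> 0"
  have *: "\<exists>a. 0 \<le> a \<and> a \<le> 2 * pi \<and> cis a = z" if "norm z = 1" for z
    using Arg2pi[of z] that by (intro exI[of _ "Arg2pi z"]) (auto simp: is_Arg_def cis_conv_exp)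
  have cont': "continuous_on {0..P} (\<lambda>t. \<sigma> * (\<beta> t - \<alpha>))"
    by (intro continuous_intros continuous_on_subset[OF cont]) auto
  from \<sigma> consider "\<sigma> = 1" | "\<sigma> = -1" by linarith
  then show ?thesis
  proof cases
    case 1
    obtain a where a: "0 \<le> a" "a \<le> 2 * pi" "cis a = u * cis (- \<alpha>)"
      using *[of "u * cis (- \<alpha>)"] u by (auto simp: norm_mult)
    obtain s where "\<sigma> * (\<beta> s - \<alpha>) = a"
      using IVT'[of "\<lambda>t. \<sigma> * (\<beta> t - \<alpha>)" 0 a P] a P turn cont' 1 by (auto simp: \<alpha>_def)
    then have "\<beta> s = \<alpha> + a" using 1 by simp
    then have "cis (\<beta> s) = cis \<alpha> * cis a" by (simp add: cis_mult)
    also have "\<dots> = u * (cis \<alpha> * cis (- \<alpha>))" by (simp add: a ac_simps)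
    finally show ?thesis by (auto simp: cis_mult)
  next
    case 2
    \<comment> \<open>The angle now decreases, so the swept amount \<open>a\<close> is measured
      clockwise from \<open>\<alpha>\<close> to \<open>u\<close>; this is why \<open>u\<close>
      enters conjugated.\<close>
    obtain a where a: "0 \<le> a" "a \<le> 2 * pi" "cis a = cnj u * cis \<alpha>"
      using *[of "cnj u * cis \<alpha>"] u by (auto simp: norm_mult)
    obtain s where "\<sigma> * (\<beta> s - \<alpha>) = a"
      using IVT'[of "\<lambda>t. \<sigma> * (\<beta> t - \<alpha>)" 0 a P] a P turn cont' 2 by (auto simp: \<alpha>_def)
    then have "\<beta> s = \<alpha> - a" using 2 by simp
    then have "cis (\<beta> s) = cis \<alpha> * cnj (cis a)" by (simp add: cis_mult cis_cnj)
    also have "\<dots> = u * (cis \<alpha> * cis (- \<alpha>))" by (simp add: a cis_cnj ac_simps)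
    finally show ?thesis by (auto simp: cis_mult)
  qed
qed

text \<open>The strict support criterion applied to the normals
  \<open>cis (\<beta> s)\<close>.\<close>

lemma convex_curve_of_turning:
  fixes \<Gamma> :: "real \<Rightarrow> complex" and \<beta> \<rho> :: "real \<Rightarrow> real" and \<sigma> :: real
  assumes "P > 0" "\<bar>\<sigma>\<bar> = 1"
    and der: "\<And>t. (\<Gamma> has_vector_derivative \<rho> t *\<^sub>R (\<i> * cis (\<beta> t))) (at t)"
    and "\<And>t. \<sigma> * \<rho> t > 0"
    and "strict_mono (\<lambda>t. \<sigma> * \<beta> t)" and "continuous_on UNIV \<beta>"
    and "\<And>t. \<Gamma> (t + P) = \<Gamma> t" and turn: "\<And>t. \<beta> (t + P) = \<beta> t + \<sigma> * (2 * pi)"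
  shows "convex_curve P \<Gamma>"
proof (rule convex_curveI_strict_support)
  show "continuous_on UNIV \<Gamma>"
    using der by (meson continuous_at_imp_continuous_on has_vector_derivative_continuous)
  show "(\<Gamma> t - \<Gamma> s) \<bullet> cis (\<beta> s) < 0" if "s < t" "t < s + P" for s t
    by (rule strict_support_of_turning[where \<rho> = \<rho> and \<sigma> = \<sigma> and P = P]) (use assms that in auto)
  show "\<exists>s. cis (\<beta> s) = u" if "norm u = 1" for u
    by (rule cis_surj_of_turning[where \<sigma> = \<sigma> and P = P]) (use assms turn[of 0] that in auto)
qed (use assms in auto)


subsection \<open>The segment tangent to a front\<close>

text \<open>The speed repeats after half the period of the curve, so every arc of parameter length
  \<open>T\<close> is half the perimeter. The bound \<open>c\<close> makes this half positive and
  thus strictly smaller than the whole.\<close>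

lemma bicycle_curve_of_periodic_speed:
  fixes \<Gamma> :: "real \<Rightarrow> complex" and N :: "real \<Rightarrow> real"
  assumes "smooth_closed_curve (2 * T) \<Gamma>" and "T > 0" and "d > 0"
    and N: "\<And>t. norm (vector_derivative \<Gamma> (at t)) = N t" "\<And>t. N (t + T) = N t"
    and Ncont: "continuous_on UNIV N" and c: "c > 0" "\<And>t. c \<le> N t"
    and d: "\<And>t. dist (\<Gamma> t) (\<Gamma> (t + T)) = d"
  shows "bicycle_curve (2 * T) \<Gamma>"
proof -
  have int: "N integrable_on {u..v}" for u v
    by (intro integrable_continuous_real continuous_on_subset[OF Ncont]) auto
  have al: "arc_length \<Gamma> u v = integral {u..v} N" for u v
    unfolding arc_length_def N(1) ..
  define l where "l = integral {0..T} N"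
  have half: "arc_length \<Gamma> u (u + T) = l" for u
    unfolding al l_def by (rule integral_period) (use assms in auto)
  have "integral {0..T} (\<lambda>_. c) \<le> l"
    unfolding l_def by (rule integral_le) (use int c in auto)
  then have l: "l > 0"
    using c(1) \<open>T > 0\<close> by (simp add: less_le_trans[OF mult_pos_pos[of T c]])
  have "integral {0..T} N + integral {T..2 * T} N = integral {0..2 * T} N"
    by (rule Henstock_Kurzweil_Integration.integral_combine) (use \<open>T > 0\<close> int in auto)
  then have total: "arc_length \<Gamma> 0 (2 * T) = l + l"
    using half[of 0] half[of T] by (simp add: al)
  \<comment> \<open>The parameter is rescaled so that \<open>s\<close> to \<open>s + 1\<close> is
    one full traversal; the second point runs half a period ahead.\<close>
  define x y where "x = (\<lambda>s. 2 * T * s)" and "y = (\<lambda>s. 2 * T * s + T)"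
  have "continuous_on UNIV x" "continuous_on UNIV y" "strict_mono x" "strict_mono y"
    using \<open>T > 0\<close> by (auto simp: x_def y_def intro!: continuous_intros strict_monoI)
  moreover have "\<forall>s. x (s + 1) = x s + 2 * T" "\<forall>s. y (s + 1) = y s + 2 * T"
    by (simp_all add: x_def y_def algebra_simps)
  moreover have "\<forall>s. x s < y s \<and> arc_length \<Gamma> (x s) (y s) = l"
    using half \<open>T > 0\<close> by (simp add: x_def y_def)
  moreover have "\<forall>s. dist (\<Gamma> (x s)) (\<Gamma> (y s)) = d"
    using d by (simp add: x_def y_def)
  moreover have "0 < l" "l < arc_length \<Gamma> 0 (2 * T)"
    using l total by simp_all
  ultimately show ?thesis
    unfolding bicycle_curve_def using assms(1) \<open>d > 0\<close>
    by (intro conjI[OF assms(1)] exI[where x = l] exI[where x = d] exI[where x = x] exI[where x = y])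
      simp_all
qed

text \<open>
  The left-hand side is the velocity of the endpoint for \<open>a = \<theta>\<close> and \<open>b = L \<theta>'\<close>.
\<close>

lemma velocity_polar_form:
  fixes v b a :: real
  assumes "b \<noteq> 0"
  shows "v *\<^sub>R cis a + b *\<^sub>R (\<i> * cis a) =
    (b * sqrt (1 + (v / b)\<^sup>2)) *\<^sub>R (\<i> * cis (a - arctan (v / b)))"
proof -
  define w where "w = v / b"
  have s: "sqrt (1 + w\<^sup>2) \<noteq> 0" by (smt (verit) real_sqrt_eq_zero_cancel_iff zero_le_power2)
  \<comment> \<open>Right triangle with legs 1 and \<open>w\<close>. The factor \<open>b\<close> is
    kept outside with its sign, so \<open>arctan\<close> needs no change of branch.\<close>
  have "sqrt (1 + w\<^sup>2) *\<^sub>R cis (- arctan w) = 1 - w *\<^sub>R \<i>"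
    using s by (simp add: complex_eq_iff cos_arctan sin_arctan)
  moreover have "cis (a - arctan w) = cis (- arctan w) * cis a"
    by (simp add: cis_mult)
  ultimately have "(b * sqrt (1 + w\<^sup>2)) *\<^sub>R (\<i> * cis (a - arctan w))
      = b *\<^sub>R (\<i> * ((1 - w *\<^sub>R \<i>) * cis a))"
    by (metis (no_types, lifting) mult_scaleR_left mult_scaleR_right scaleR_scaleR)
  also have "\<dots> = (b * w) *\<^sub>R cis a + b *\<^sub>R (\<i> * cis a)"
    by (simp add: complex_eq_iff algebra_simps)
  also have "b * w = v" using assms by (simp add: w_def)
  finally show ?thesis by (simp add: w_def)
qed

text \<open>The increment \<open>c\<close> is allowed because \<open>\<theta>\<close> gains a
  multiple of \<open>pi\<close> per traversal.\<close>

lemma has_vector_derivative_periodic: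
  assumes "\<And>t. (f has_vector_derivative f' t) (at t)" "\<And>t. f (t + T) = f t + c"
  shows "f' (t + T) = f' t"
proof -
  have "((\<lambda>t. f (t + T)) has_vector_derivative f' (t + T)) (at t)"
    using vector_diff_chain_at[of "\<lambda>t. t + T" 1 t f, OF _ assms(1)]
    by (simp add: o_def has_vector_derivative_def has_derivative_add_const)
  moreover have "((\<lambda>t. f t + c) has_vector_derivative f' t) (at t)"
    by (auto intro!: derivative_eq_intros assms(1))
  ultimately show ?thesis
    using assms(2) vector_derivative_unique_at by fastforce
qed

theorem theorem2:
  fixes T :: real and \<gamma> :: "real \<Rightarrow> complex" and \<theta> :: "real \<Rightarrow> real"
  assumes "wave_front T \<gamma> \<theta>"
    and "odd (card (cusps T \<gamma> \<theta>))"
    and "total_rotation T \<theta> = pi"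
    and "without_inflections \<theta>"
  shows "\<forall>\<^sub>F L :: real in at_top. \<exists>\<Gamma> :: real \<Rightarrow> complex.
    (\<forall>t. \<Gamma> t = \<gamma> t + L *\<^sub>R cis (\<theta> t)) \<and>
    (\<forall>t. \<Gamma> (t + T) = \<gamma> t - L *\<^sub>R cis (\<theta> t)) \<and>
    smooth_closed_curve (2 * T) \<Gamma> \<and>
    convex_curve (2 * T) \<Gamma> \<and>
    bicycle_curve (2 * T) \<Gamma>"
proof -

  \<comment> \<open>Derivatives of the front and of its tangent angle\<close>
  have T: "T > 0" and sm: "smooth \<gamma>" "smooth \<theta>" and \<gamma>_per: "\<And>t. \<gamma> (t + T) = \<gamma> t"
    and tangent: "\<And>t. \<exists>v::real. vector_derivative \<gamma> (at t) = v *\<^sub>R cis (\<theta> t)"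
    using assms(1) unfolding wave_front_def by blast+
  obtain k :: int where \<theta>_per: "\<And>t. \<theta> (t + T) = \<theta> t + of_int k * pi"
    using assms(1) unfolding wave_front_def by blast
  obtain G where G0: "G 0 = \<gamma>" and G: "\<And>n t. (G n has_vector_derivative G (Suc n) t) (at t)"
    using sm(1) unfolding smooth_def by blast
  obtain H where H0: "H 0 = \<theta>" and H: "\<And>n t. (H n has_vector_derivative H (Suc n) t) (at t)"
    using sm(2) unfolding smooth_def by blast
  define \<theta>1 \<theta>2 where "\<theta>1 = H 1" and "\<theta>2 = H 2"
  have \<theta>1: "(\<theta> has_vector_derivative \<theta>1 t) (at t)" and \<theta>2: "(\<theta>1 has_vector_derivative \<theta>2 t) (at t)" for t
    using H[of 0 t] H[of 1 t] H0 by (simp_all add: \<theta>1_def \<theta>2_def numeral_2_eq_2)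
  have \<gamma>1: "(\<gamma> has_vector_derivative G 1 t) (at t)" for t
    using G[of 0 t] G0 by simp
  have contG: "continuous_on UNIV (G n)" and contH: "continuous_on UNIV (H n)" for n
    using G H by (meson continuous_at_imp_continuous_on has_vector_derivative_continuous)+
  have cont\<theta>: "continuous_on UNIV \<theta>" "continuous_on UNIV \<theta>1" "continuous_on UNIV \<theta>2"
    using contH[of 0] contH[of 1] contH[of 2] by (simp_all add: H0 \<theta>1_def \<theta>2_def)
  have \<theta>1_nz: "\<theta>1 t \<noteq> 0" for t
    using assms(4) \<theta>1[of t] unfolding without_inflections_def
    by (metis DERIV_imp_deriv has_real_derivative_iff_has_vector_derivative)

  \<comment> \<open>Signed speed and radius of curvature\<close>
  define v where "v = (\<lambda>t. G 1 t \<bullet> cis (\<theta> t))"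
  have \<gamma>1_v: "G 1 t = v t *\<^sub>R cis (\<theta> t)" for t
  proof -
    obtain w where "G 1 t = w *\<^sub>R cis (\<theta> t)"
      using tangent[of t] vector_derivative_at[OF \<gamma>1[of t]] by auto
    moreover from this have "w = v t" by (simp add: v_def dot_square_norm)
    ultimately show ?thesis by simp
  qed
  define v' where "v' = (\<lambda>t. G 1 t \<bullet> (\<theta>1 t *\<^sub>R (\<i> * cis (\<theta> t))) + G 2 t \<bullet> cis (\<theta> t))"
  have v': "(v has_vector_derivative v' t) (at t)" for t
    unfolding v_def v'_def
    using bounded_bilinear.has_vector_derivative[OF bounded_bilinear_inner
        G[of 1 t] has_vector_derivative_cis[OF \<theta>1[of t]]] by (simp add: numeral_2_eq_2)
  have contv: "continuous_on UNIV v" "continuous_on UNIV v'"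
    unfolding v_def v'_def by (intro continuous_intros contG cont\<theta>)+

  \<comment> \<open>The signed radius of curvature, the reciprocal of
    \<open>front_curvature\<close>. Since \<open>\<theta>1\<close> never vanishes, it stays
    differentiable through the cusps, where it is 0.\<close>
  define q where "q = (\<lambda>t. v t / \<theta>1 t)"
  define q' where "q' = (\<lambda>t. (v' t * \<theta>1 t - v t * \<theta>2 t) / (\<theta>1 t * \<theta>1 t))"
  have q': "(q has_real_derivative q' t) (at t)" for t
    unfolding q_def q'_def using v'[of t] \<theta>2[of t] \<theta>1_nz[of t]
    by (intro DERIV_divide) (simp_all add: has_real_derivative_iff_has_vector_derivative)
  have contq': "continuous_on UNIV q'"
    unfolding q'_def using \<theta>1_nz by (intro continuous_intros contv cont\<theta>) auto

  \<comment> \<open>Sense of rotation and periodicity\<close>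
  obtain \<sigma> :: real where \<sigma>: "\<bar>\<sigma>\<bar> = 1" and \<sigma>\<theta>1: "\<And>t. \<sigma> * \<theta>1 t = \<bar>\<theta>1 t\<bar>"
  proof -
    have conn: "connected (range \<theta>1)"
      using cont\<theta>(2) by (intro connected_continuous_image) auto
    have "\<not> (\<theta>1 s < 0 \<and> \<theta>1 t > 0)" for s t
      using connectedD_interval[OF conn, of "\<theta>1 s" "\<theta>1 t" 0] \<theta>1_nz by force
    then have "(\<forall>t. \<theta>1 t > 0) \<or> (\<forall>t. \<theta>1 t < 0)"
      using \<theta>1_nz by (metis linorder_neqE_linordered_idom)
    then show thesis
    proof
      assume "\<forall>t. \<theta>1 t > 0"
      then show thesis by (intro that[of 1]) (auto simp: less_imp_le)
    next
      assume "\<forall>t. \<theta>1 t < 0"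
      then show thesis by (intro that[of "-1"]) (auto simp: less_imp_le)
    qed
  qed
  have k: "of_int k = \<sigma>"
  proof -
    have "\<bar>of_int k * pi\<bar> = pi"
      using assms(3) \<theta>_per[of 0] by (simp add: total_rotation_def)
    then have k1: "\<bar>real_of_int k\<bar> = 1" by (simp add: abs_mult)
    \<comment> \<open>With \<open>k\<close> known up to sign, the mean value theorem over one
      traversal ties its sign to that of \<open>\<theta>1\<close>.\<close>
    obtain z where "\<theta> T - \<theta> 0 = T * \<theta>1 z"
      using MVT2[of 0 T \<theta> \<theta>1] T \<theta>1 by (auto simp: has_real_derivative_iff_has_vector_derivative)
    then have "of_int k * pi = T * \<theta>1 z" using \<theta>_per[of 0] by simp
    then have "\<sigma> * of_int k * pi = T * (\<sigma> * \<theta>1 z)" by (simp add: algebra_simps)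
    also have "\<dots> > 0" using \<sigma>\<theta>1[of z] \<theta>1_nz[of z] T by simp
    finally have "\<sigma> * of_int k > 0" by (simp add: zero_less_mult_iff)
    with \<sigma> k1 show ?thesis by (auto simp: abs_if split: if_splits)
  qed
  \<comment> \<open>The half turn reverses the oriented segment over the same midpoint: this
    exchanges the endpoints, and it flips \<open>v\<close> because the velocity of the front is
    unchanged.\<close>
  have cis_per: "cis (\<theta> (t + T)) = - cis (\<theta> t)" for t
    using \<sigma> by (auto simp: \<theta>_per k abs_if complex_eq_iff split: if_splits)
  have \<theta>1_per: "\<theta>1 (t + T) = \<theta>1 t" for t
    by (rule has_vector_derivative_periodic[OF \<theta>1 \<theta>_per])
  have \<gamma>1_per: "G 1 (t + T) = G 1 t" for t
    by (rule has_vector_derivative_periodic[OF \<gamma>1, of _ 0]) (simp add: \<gamma>_per)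
  have v_per: "v (t + T) = - v t" for t
    unfolding v_def \<gamma>1_per cis_per by (rule inner_minus_right)
  have q_per: "q (t + 2 * T) = q t" for t
    using v_per[of "t + T"] v_per[of t] \<theta>1_per[of "t + T"] \<theta>1_per[of t]
    by (simp add: q_def algebra_simps)
  have q'_per: "q' (t + 2 * T) = q' t" for t
    by (rule has_vector_derivative_periodic[of q q' "2 * T" 0])
      (use q' q_per in \<open>auto simp: has_real_derivative_iff_has_vector_derivative\<close>)

  \<comment> \<open>Uniform bounds that fix the threshold for \<open>L\<close>\<close>
  obtain M where M: "M > 0" "\<And>t. \<bar>q' t\<bar> \<le> M"
  proof -
    have "bounded (range q')"
      using compact_range_periodic[of "2 * T" q', OF _ q'_per contq'] T by (simp add: compact_imp_bounded)
    then show thesis using that unfolding bounded_pos by auto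
  qed
  obtain m where m: "m > 0" "\<And>t. m \<le> \<bar>\<theta>1 t\<bar>"
  proof -
    have "compact (range (\<lambda>t. \<bar>\<theta>1 t\<bar>))"
      by (rule compact_range_periodic[OF T]) (auto simp: \<theta>1_per intro!: continuous_intros cont\<theta>)
    then obtain z where "\<And>t. \<bar>\<theta>1 z\<bar> \<le> \<bar>\<theta>1 t\<bar>"
      using compact_attains_inf[of "range (\<lambda>t. \<bar>\<theta>1 t\<bar>)"] by auto
    then show thesis using that[of "\<bar>\<theta>1 z\<bar>"] \<theta>1_nz[of z] by auto
  qed

  \<comment> \<open>Properties of the endpoint curve\<close>
  have main: "(\<forall>t. \<Gamma> (t + T) = \<gamma> t - L *\<^sub>R cis (\<theta> t)) \<and> smooth_closed_curve (2 * T) \<Gamma> \<and>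
      convex_curve (2 * T) \<Gamma> \<and> bicycle_curve (2 * T) \<Gamma>"
    if L: "L > M / m" and \<Gamma>: "\<Gamma> = (\<lambda>t. \<gamma> t + L *\<^sub>R cis (\<theta> t))" for L \<Gamma>
  proof (intro conjI)
    have L0: "L > 0" using L M(1) m(1) by (smt (verit) divide_pos_pos)
    show half: "\<forall>t. \<Gamma> (t + T) = \<gamma> t - L *\<^sub>R cis (\<theta> t)"
      by (simp add: \<Gamma> \<gamma>_per cis_per)
    have \<Gamma>_per: "\<Gamma> (t + 2 * T) = \<Gamma> t" for t
      using half \<gamma>_per[of t] cis_per[of t] by (metis \<Gamma> add.assoc mult_2 scaleR_minus_right diff_minus_eq_add)
    have der: "(\<Gamma> has_vector_derivative v t *\<^sub>R cis (\<theta> t) + (L * \<theta>1 t) *\<^sub>R (\<i> * cis (\<theta> t))) (at t)" for t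
      unfolding \<Gamma> \<gamma>1_v[symmetric]
      by (rule has_vector_derivative_add[OF \<gamma>1])
        (use bounded_linear.has_vector_derivative[OF bounded_linear_scaleR_right[of L]
            has_vector_derivative_cis[OF \<theta>1[of t]]] in simp)
    define N where "N = (\<lambda>t. sqrt ((v t)\<^sup>2 + (L * \<theta>1 t)\<^sup>2))"
    have speed: "norm (vector_derivative \<Gamma> (at t)) = N t" for t
    proof -
      \<comment> \<open>The two velocity components are orthogonal; a common rotation turns the norm
        into Pythagoras.\<close>
      have "v t *\<^sub>R cis (\<theta> t) + (L * \<theta>1 t) *\<^sub>R (\<i> * cis (\<theta> t)) = Complex (v t) (L * \<theta>1 t) * cis (\<theta> t)"
        by (simp add: complex_eq_iff)
      then show ?thesis
        using vector_derivative_at[OF der[of t]] by (simp add: norm_mult N_def complex_norm)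
    qed
    \<comment> \<open>The rotational component alone keeps the speed positive, also at cusps, where
      \<open>v\<close> vanishes.\<close>
    have N_ge: "L * m \<le> N t" for t
    proof -
      have "L * m \<le> \<bar>L * \<theta>1 t\<bar>" using m(2)[of t] L0 by (simp add: abs_mult)
      also have "\<dots> \<le> N t" unfolding N_def by (rule real_le_rsqrt) simp
      finally show ?thesis .
    qed
    show closed: "smooth_closed_curve (2 * T) \<Gamma>"
      unfolding smooth_closed_curve_def
    proof (intro conjI allI)
      show "vector_derivative \<Gamma> (at t) \<noteq> 0" for t
        using speed[of t] N_ge[of t] mult_pos_pos[OF L0 m(1)] by auto
    qed (use T \<Gamma>_per smooth_add_scaleR_cis[OF sm] in \<open>auto simp: \<Gamma>\<close>)

    show "bicycle_curve (2 * T) \<Gamma>"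
    proof (rule bicycle_curve_of_periodic_speed[OF closed T _ speed _ _ _ N_ge])
      show "dist (\<Gamma> t) (\<Gamma> (t + T)) = 2 * L" for t
      proof -
        have "\<Gamma> t - \<Gamma> (t + T) = (2 * L) *\<^sub>R cis (\<theta> t)"
          using half by (simp add: \<Gamma> flip: scaleR_add_left)
        then show ?thesis using L0 by (simp add: dist_norm)
      qed
      show "continuous_on UNIV N"
        unfolding N_def by (intro continuous_intros contv cont\<theta>)
    qed (use L0 m(1) in \<open>auto simp: N_def v_per \<theta>1_per\<close>)

    define \<beta> where "\<beta> = (\<lambda>t. \<theta> t - arctan (v t / (L * \<theta>1 t)))"
    define \<rho> where "\<rho> = (\<lambda>t. L * \<theta>1 t * sqrt (1 + (v t / (L * \<theta>1 t))\<^sup>2))"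
    \<comment> \<open>In this form \<open>L\<close> only scales a fixed function \<open>q\<close>,
      so the correction to \<open>\<theta>\<close> has a derivative of order
      \<open>1 / L\<close>.\<close>
    have \<beta>_q: "\<beta> t = \<theta> t - arctan (q t / L)" for t
      by (simp add: \<beta>_def q_def mult.commute)
    define \<beta>' where "\<beta>' = (\<lambda>t. \<theta>1 t - (q' t / L) / (1 + (q t / L)\<^sup>2))"
    have \<beta>': "(\<beta> has_real_derivative \<beta>' t) (at t)" for t
      unfolding \<beta>_q[abs_def] \<beta>'_def
      using \<theta>1[of t] q'[of t] L0
      by (auto intro!: derivative_eq_intros
          simp: has_real_derivative_iff_has_vector_derivative[symmetric] field_simps)
    have \<beta>'_pos: "\<sigma> * \<beta>' t > 0" for t
    proof -
      \<comment> \<open>The denominator is at least 1, so the correction to \<open>\<theta>1\<close>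
        is at most \<open>M / L\<close>. The choice \<open>L > M / m\<close> puts this below
        \<open>m\<close>, and so \<open>\<beta>'\<close> keeps the sign of
        \<open>\<theta>1\<close>.\<close>
      define e where "e = (q' t / L) / (1 + (q t / L)\<^sup>2)"
      have "\<bar>e\<bar> = \<bar>q' t / L\<bar> / (1 + (q t / L)\<^sup>2)"
        unfolding e_def abs_divide[of "q' t / L"] by (simp add: abs_of_nonneg)
      also have "\<dots> \<le> \<bar>q' t / L\<bar> / 1"
        by (intro divide_left_mono) (auto intro: add_pos_nonneg)
      also have "\<dots> \<le> M / L"
        using M(2)[of t] L0 by (simp add: abs_divide divide_right_mono)
      also have "\<dots> < m" using L L0 m(1) by (simp add: field_simps)
      finally have "\<bar>\<sigma> * e\<bar> < \<bar>\<theta>1 t\<bar>" using \<sigma> m(2)[of t] by (simp add: abs_mult)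
      then have "\<sigma> * e < \<sigma> * \<theta>1 t" using \<sigma>\<theta>1[of t] by linarith
      then show ?thesis by (simp add: \<beta>'_def e_def right_diff_distrib)
    qed
    show "convex_curve (2 * T) \<Gamma>"
    proof (rule convex_curve_of_turning[where \<sigma> = \<sigma> and \<rho> = \<rho> and \<beta> = \<beta>])
      show "(\<Gamma> has_vector_derivative \<rho> t *\<^sub>R (\<i> * cis (\<beta> t))) (at t)" for t
        using der[of t] velocity_polar_form[of "L * \<theta>1 t" "v t" "\<theta> t"] \<theta>1_nz[of t] L0
        by (simp add: \<rho>_def \<beta>_def)
      show "0 < \<sigma> * \<rho> t" for t
      proof -
        have "\<sigma> * \<rho> t = L * (\<sigma> * \<theta>1 t) * sqrt (1 + (v t / (L * \<theta>1 t))\<^sup>2)"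
          by (simp add: \<rho>_def)
        also have "\<dots> > 0"
          unfolding \<sigma>\<theta>1 using L0 \<theta>1_nz[of t]
          by (intro mult_pos_pos) (auto intro: add_pos_nonneg)
        finally show ?thesis .
      qed
      show "strict_mono (\<lambda>t. \<sigma> * \<beta> t)"
        by (rule strict_monoI, rule DERIV_pos_imp_increasing)
          (use \<beta>' \<beta>'_pos in \<open>auto intro!: DERIV_cmult\<close>)
      show "continuous_on UNIV \<beta>"
        using \<beta>' by (meson DERIV_isCont continuous_at_imp_continuous_on)
      \<comment> \<open>The \<open>arctan\<close> term returns to its value after
        \<open>2 * T\<close>, leaving the two half turns of \<open>\<theta>\<close>.\<close>
      show "\<beta> (t + 2 * T) = \<beta> t + \<sigma> * (2 * pi)" for t
        using \<theta>_per[of "t + T"] \<theta>_per[of t] unfolding \<beta>_q q_per k by (simp add: algebra_simps)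
    qed (use T \<sigma> \<Gamma>_per in auto)
  qed
  show ?thesis
  proof (rule eventually_mono[OF eventually_gt_at_top[of "M / m"]])
    fix L assume "L > M / m"
    from main[OF this refl]
    show "\<exists>\<Gamma> :: real \<Rightarrow> complex.
      (\<forall>t. \<Gamma> t = \<gamma> t + L *\<^sub>R cis (\<theta> t)) \<and>
      (\<forall>t. \<Gamma> (t + T) = \<gamma> t - L *\<^sub>R cis (\<theta> t)) \<and>
      smooth_closed_curve (2 * T) \<Gamma> \<and>
      convex_curve (2 * T) \<Gamma> \<and>
      bicycle_curve (2 * T) \<Gamma>"
      by (intro exI[of _ "\<lambda>t. \<gamma> t + L *\<^sub>R cis (\<theta> t)"]) auto
  qed
qed

end
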